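(* The following four assertions are equivalent (each one holds if and only if each of the others holds): $$\text{(i)}\quad -\frac12(\pi+2)=-3\cdot 1+\cfrac{-2\cdot 1}{-3\cdot 2+\cfrac{-3\cdot 3}{-3\cdot 3+\cfrac{-4\cdot 5}{-3\cdot 4+\cfrac{-5\cdot 7}{-3\cdot 5+\ddots}}}},$$ $$\text{(ii)}\quad \frac12(\pi+2)=3\cdot 1+\cfrac{-2\cdot 1}{3\cdot 2+\cfrac{-3\cdot 3}{3\cdot 3+\cfrac{-4\cdot 5}{3\cdot 4+\cfrac{-5\cdot 7}{3\cdot 5+\ddots}}}},$$ $$\text{(iii)}\quad -\frac12(\pi+2)=-3\cdot 1+\cfrac{2\cdot 1}{3\cdot 2+\cfrac{3\cdot 3}{-3\cdot 3+\cfrac{4\cdot 5}{3\cdot 4+\cfrac{5\cdot 7}{-3\cdot 5+\ddots}}}},$$ $$\text{(iv)}\quad \frac12(\pi+2)=3\cdot 1+\cfrac{2\cdot 1}{-3\cdot 2+\cfrac{3\cdot 3}{3\cdot 3+\cfrac{4\cdot 5}{-3\cdot 4+\cfrac{5\cdot 7}{3\cdot 5+\ddots}}}}.$$ Here, writing each continued fraction as $b_0+\cfrac{a_1}{b_1+\cfrac{a_2}{b_2+\ddots}}$, the general terms (for $n\ge1$ in $a_n$ and $n\ge0$ in $b_n$) are: in (i), $a_n=-(n+1)(2n-1)$ and $b_n=-3(n+1)$; in (ii), $a_n=-(n+1)(2n-1)$ and $b_n=3(n+1)$; in (iii), $a_n=(n+1)(2n-1)$ and $b_n=(-1)^{n+1}3(n+1)$;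 in (iv), $a_n=(n+1)(2n-1)$ and $b_n=(-1)^{n}3(n+1)$.
   Context: For sequences of numbers $(a_n)_{n\ge1}$ and $(b_n)_{n\ge0}$, the $n$-th convergent $A_n/B_n$ of the (generalized) continued fraction $b_0+\cfrac{a_1}{b_1+\cfrac{a_2}{b_2+\ddots}}$ is its truncation at $a_n/b_n$. The sequences $(A_n)$, $(B_n)$ satisfy $A_n=b_nA_{n-1}+a_nA_{n-2}$ and $B_n=b_nB_{n-1}+a_nB_{n-2}$ for $n\ge1$, with $A_{-1}=1$, $A_0=b_0$, $B_{-1}=0$, $B_0=1$. An assertion that a number $x$ equals the continued fraction means $\lim_{n\to\infty}A_n/B_n=x$. *)

theory Defs
  imports Complex_Main
begin

text \<open>
  Canonical numerators \<open>A\<^sub>n\<close> and denominators \<open>B\<^sub>n\<close> of \<open>b\<^sub>0 + a\<^sub>1 / (b\<^sub>1 + a\<^sub>2 / (b\<^sub>2 + \<dots>))\<close>.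
  The case \<open>n = 1\<close> is the general recurrence with \<open>A\<^sub>-\<^sub>1 = 1\<close> and \<open>B\<^sub>-\<^sub>1 = 0\<close> inserted;
  the value \<open>a 0\<close> is never used.
\<close>

fun cfrac_num :: "(nat \<Rightarrow> 'a::field) \<Rightarrow> (nat \<Rightarrow> 'a) \<Rightarrow> nat \<Rightarrow> 'a" where
  "cfrac_num a b 0 = b 0"
| "cfrac_num a b (Suc 0) = b 1 * b 0 + a 1 * 1"
| "cfrac_num a b (Suc (Suc n)) =
     b (Suc (Suc n)) * cfrac_num a b (Suc n) + a (Suc (Suc n)) * cfrac_num a b n"

fun cfrac_den :: "(nat \<Rightarrow> 'a::field) \<Rightarrow> (nat \<Rightarrow> 'a) \<Rightarrow> nat \<Rightarrow> 'a" where
  "cfrac_den a b 0 = 1"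
| "cfrac_den a b (Suc 0) = b 1 * 1 + a 1 * 0"
| "cfrac_den a b (Suc (Suc n)) =
     b (Suc (Suc n)) * cfrac_den a b (Suc n) + a (Suc (Suc n)) * cfrac_den a b n"

text \<open>
  The first conjunct says that the convergents \<open>A\<^sub>n / B\<^sub>n\<close> are eventually defined. It is needed
  because division by zero is total here, so that convergents with \<open>B\<^sub>n = 0\<close> would otherwise
  silently count as \<open>0\<close> in the limit.
\<close>

definition cfrac_has_value ::
  "(nat \<Rightarrow> 'a::real_normed_field) \<Rightarrow> (nat \<Rightarrow> 'a) \<Rightarrow> 'a \<Rightarrow> bool" where
  "cfrac_has_value a b x \<longleftrightarrow>
     (\<forall>\<^sub>F n in sequentially. cfrac_den a b n \<noteq> 0) \<and>
     (\<lambda>n. cfrac_num a b n / cfrac_den a b n) \<longlonglongrightarrow> x"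

end

theory Submission
  imports Defs
begin

text \<open>
  Multiplying numerator and denominator of the \<open>n\<close>-th nested fraction by a nonzero \<open>e\<^sub>n\<close> does not
  change its value. This replaces \<open>b\<^sub>n\<close> by \<open>e\<^sub>n b\<^sub>n\<close> and \<open>a\<^sub>n\<close> by \<open>e\<^sub>n\<^sub>-\<^sub>1 e\<^sub>n a\<^sub>n\<close>; letting it start at \<open>n = 0\<close>
  additionally multiplies the whole fraction by \<open>e\<^sub>0\<close>. The four continued fractions of the
  theorem arise from the first one in this way: the second, third and fourth by
  \<open>e\<^sub>n = -1\<close>, \<open>e\<^sub>n = (-1)\<^sup>n\<close> and \<open>e\<^sub>n = (-1)\<^sup>n\<^sup>+\<^sup>1\<close>. Then \<open>e\<^sub>0\<close> is \<open>-1\<close>, \<open>1\<close> and \<open>-1\<close>, exactly the sign of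
  the claimed limit relative to the first. So each assertion is equivalent to the first, by
  \<open>cfrac_has_value_equivalence\<close>.
\<close>

text \<open>
  Each step of the recurrence is homogeneous, so it contributes one factor \<open>e\<^sub>n\<close>. The
  numerators also collect \<open>e\<^sub>0\<close>, since they start at \<open>b\<^sub>0\<close> and the denominators at \<open>1\<close>.
\<close>

lemma
  fixes a a' b b' e :: "nat \<Rightarrow> 'a::field"
  assumes b': "\<And>n. b' n = e n * b n"
    and a': "\<And>n. a' (Suc n) = e n * e (Suc n) * a (Suc n)"
  shows cfrac_num_equivalence: "cfrac_num a' b' n = (\<Prod>k\<le>n. e k) * cfrac_num a b n"
    and cfrac_den_equivalence: "cfrac_den a' b' n = (\<Prod>k=1..n. e k) * cfrac_den a b n"
proof -
  have a1: "a' 1 = e 0 * e 1 * a 1"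
    using a'[of 0] by simp
  show "cfrac_num a' b' n = (\<Prod>k\<le>n. e k) * cfrac_num a b n"
  proof (induction n rule: induct_nat_012)
    case 0
    show ?case by (simp add: b')
  next
    case 1
    show ?case using a1 by (simp add: b' algebra_simps)
  next
    case (ge2 n)
    then show ?case by (simp add: a' b' algebra_simps)
  qed
  show "cfrac_den a' b' n = (\<Prod>k=1..n. e k) * cfrac_den a b n"
  proof (induction n rule: induct_nat_012)
    case 0
    show ?case by simp
  next
    case 1
    show ?case by (simp add: b')
  next
    case (ge2 n)
    then show ?case by (simp add: a' b' algebra_simps)
  qed
qed

text \<open>
  The convergents are multiplied by \<open>e\<^sub>0\<close>, all other factors cancelling. As no \<open>e\<^sub>n\<close> vanishes, the
  same convergents are defined on both sides.
\<close>

lemma cfrac_has_value_equivalence: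
  fixes a a' b b' e :: "nat \<Rightarrow> 'a::real_normed_field"
  assumes e: "\<And>n. e n \<noteq> 0"
    and b': "\<And>n. b' n = e n * b n"
    and a': "\<And>n. a' (Suc n) = e n * e (Suc n) * a (Suc n)"
  shows "cfrac_has_value a' b' (e 0 * x) \<longleftrightarrow> cfrac_has_value a b x"
proof -
  note num = cfrac_num_equivalence[where a' = a' and b' = b' and e = e, OF b' a']
    and den = cfrac_den_equivalence[where a' = a' and b' = b' and e = e, OF b' a']
  have "cfrac_den a' b' n \<noteq> 0 \<longleftrightarrow> cfrac_den a b n \<noteq> 0" for n
    using e by (simp add: den)
  moreover have "cfrac_num a' b' n / cfrac_den a' b' n
      = e 0 * (cfrac_num a b n / cfrac_den a b n)" for n
  proof -
    have "(\<Prod>k\<le>n. e k) = e 0 * (\<Prod>k=1..n. e k)"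
      by (simp add: atMost_atLeast0 prod.atLeast_Suc_atMost)
    moreover have "(\<Prod>k=1..n. e k) \<noteq> 0"
      using e by simp
    ultimately show ?thesis
      by (simp add: num den)
  qed
  ultimately show ?thesis
    by (simp only: cfrac_has_value_def tendsto_mult_left_iff[OF e])
qed

theorem corollary4:
  "let i = cfrac_has_value (\<lambda>n. - ((real n + 1) * (2 * real n - 1)))
             (\<lambda>n. - 3 * (real n + 1)) (- (1 / 2) * (pi + 2));
       ii = cfrac_has_value (\<lambda>n. - ((real n + 1) * (2 * real n - 1)))
             (\<lambda>n. 3 * (real n + 1)) (1 / 2 * (pi + 2));
       iii = cfrac_has_value (\<lambda>n. (real n + 1) * (2 * real n - 1))
             (\<lambda>n. (- 1) ^ (n + 1) * 3 * (real n + 1)) (- (1 / 2) * (pi + 2));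
       iv = cfrac_has_value (\<lambda>n. (real n + 1) * (2 * real n - 1))
             (\<lambda>n. (- 1) ^ n * 3 * (real n + 1)) (1 / 2 * (pi + 2))
   in (i \<longleftrightarrow> ii) \<and> (i \<longleftrightarrow> iii) \<and> (i \<longleftrightarrow> iv) \<and>
      (ii \<longleftrightarrow> iii) \<and> (ii \<longleftrightarrow> iv) \<and> (iii \<longleftrightarrow> iv)"
proof -
  let ?a = "\<lambda>n. - ((real n + 1) * (2 * real n - 1))"
  let ?b = "\<lambda>n. - 3 * (real n + 1)"
  let ?x = "- (1 / 2) * (pi + 2)"
  have ii: "cfrac_has_value ?a (\<lambda>n. 3 * (real n + 1)) (- 1 * ?x)
      \<longleftrightarrow> cfrac_has_value ?a ?b ?x"
    by (rule cfrac_has_value_equivalence[where e = "\<lambda>n. - 1"]) auto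
  have iii: "cfrac_has_value (\<lambda>n. (real n + 1) * (2 * real n - 1))
        (\<lambda>n. (- 1) ^ (n + 1) * 3 * (real n + 1)) ((- 1) ^ 0 * ?x)
      \<longleftrightarrow> cfrac_has_value ?a ?b ?x"
    by (rule cfrac_has_value_equivalence[where e = "\<lambda>n. (- 1) ^ n"])
      (auto simp: algebra_simps simp flip: power_mult_distrib)
  have iv: "cfrac_has_value (\<lambda>n. (real n + 1) * (2 * real n - 1))
        (\<lambda>n. (- 1) ^ n * 3 * (real n + 1)) ((- 1) ^ (0 + 1) * ?x)
      \<longleftrightarrow> cfrac_has_value ?a ?b ?x"
    by (rule cfrac_has_value_equivalence[where e = "\<lambda>n. (- 1) ^ (n + 1)"])
      (auto simp: algebra_simps simp flip: power_mult_distrib)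
  have neg: "- 1 * ?x = 1 / 2 * (pi + 2)" "(- 1) ^ (0 + 1) * ?x = 1 / 2 * (pi + 2)"
    and pos: "(- 1) ^ 0 * ?x = ?x"
    by (simp_all add: field_simps)
  show ?thesis
    unfolding Let_def
    using ii[unfolded neg] iii[unfolded pos] iv[unfolded neg] by argo
qed

end
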